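(* The coefficients of the generating functions $F^{(1)}(x)$, $F_D^{(1)}(x)$, $F_E^{(1)}(x)$ (case $k=1$) are as follows. For every integer $n\ge 0$, $$[x^n]F^{(1)}(x)=\sum_{m\ge 0}\frac{1}{m+1}\binom{2m}{m}\binom{n+m}{3m},$$ and for every integer $n\ge 1$, $$[x^n]F_D^{(1)}(x)=\sum_{m\ge 0}\frac{1}{m+1}\binom{2m}{m}\binom{n+m-1}{3m},$$ $$[x^n]F_E^{(1)}(x)=\sum_{m\ge 1}\frac{1}{m+1}\binom{2m}{m}\binom{n+m-1}{3m-1}.$$
   Context: Write $N=(0,1)$, $E=(1,0)$, $D=(1,1)$. A Delannoy path is a lattice path in $\mathbb{Z}^2$ (finite sequence of lattice points) each of whose steps (consecutive differences) belongs to $\{N,E,D\}$. For a positive integer $k$ and a nonnegative integer $n$, $\mathcal{P}^{(k)}_{n,kn}(NE,EN)$ is the set of Delannoy paths from $(0,0)$ to $(n,kn)$ all of whose vertices lie in $\{(x,y)\in\mathbb{Z}^2: y\ge kx\}$ and which contain no two consecutive steps $NE$ (peak) and no two consecutive steps $EN$ (valley). $D\mathcal{P}^{(k)}_{n,kn}(NE,EN)$ (respectively $E\mathcal{P}^{(k)}_{n,kn}(NE,EN)$) is the subset of those paths whose last step is $D$ (respectively $E$). The generating functions are the formal power series $$F^{(k)}(x)=\sum_{n\ge 0}\#\mathcal{P}^{(k)}_{n,kn}(NE,EN)\,x^n,\quad F_D^{(k)}(x)=\sum_{n\ge 1}\#D\mathcal{P}^{(k)}_{n,kn}(NE,EN)\,x^n,\quad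 F_E^{(k)}(x)=\sum_{n\ge 1}\#E\mathcal{P}^{(k)}_{n,kn}(NE,EN)\,x^n.$$ $[x^n]G(x)$ denotes the coefficient of $x^n$ in $G(x)$. Binomial coefficients $\binom{a}{b}$ with $0\le a<b$ are $0$. *)

theory Defs
  imports
    "HOL-Analysis.Infinite_Sum"
    "HOL-Computational_Algebra.Formal_Power_Series"
    "HOL-Library.Product_Plus"
    "HOL-Library.Sublist"
begin

definition N_step :: "int \<times> int" where "N_step = (0, 1)"
definition E_step :: "int \<times> int" where "E_step = (1, 0)"
definition D_step :: "int \<times> int" where "D_step = (1, 1)"

text \<open>A lattice path is the list of its vertices; a path with \<open>l\<close> steps has \<open>l + 1\<close> vertices,
  so the one-vertex list is the path without steps.\<close>

definition steps :: "(int \<times> int) list \<Rightarrow> (int \<times> int) list" where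
  "steps p = map (\<lambda>(u, v). v - u) (zip p (tl p))"

definition delannoy_path :: "(int \<times> int) list \<Rightarrow> bool" where
  "delannoy_path p \<longleftrightarrow> p \<noteq> [] \<and> set (steps p) \<subseteq> {N_step, E_step, D_step}"

text \<open>\<open>sublist\<close> is the contiguous-factor relation, so the last two conditions exclude
  consecutive steps only.\<close>

definition paths :: "nat \<Rightarrow> nat \<Rightarrow> (int \<times> int) list set" where
  "paths k n = {p. delannoy_path p \<and> hd p = (0, 0) \<and> last p = (int n, int k * int n) \<and>
     (\<forall>(x, y) \<in> set p. y \<ge> int k * x) \<and>
     \<not> sublist [N_step, E_step] (steps p) \<and> \<not> sublist [E_step, N_step] (steps p)}"

definition D_paths :: "nat \<Rightarrow> nat \<Rightarrow> (int \<times> int) list set" where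
  "D_paths k n = {p \<in> paths k n. steps p \<noteq> [] \<and> last (steps p) = D_step}"

definition E_paths :: "nat \<Rightarrow> nat \<Rightarrow> (int \<times> int) list set" where
  "E_paths k n = {p \<in> paths k n. steps p \<noteq> [] \<and> last (steps p) = E_step}"

definition F :: "nat \<Rightarrow> real fps" where
  "F k = Abs_fps (\<lambda>n. real (card (paths k n)))"

definition F_D :: "nat \<Rightarrow> real fps" where
  "F_D k = Abs_fps (\<lambda>n. if n \<ge> 1 then real (card (D_paths k n)) else 0)"

definition F_E :: "nat \<Rightarrow> real fps" where
  "F_E k = Abs_fps (\<lambda>n. if n \<ge> 1 then real (card (E_paths k n)) else 0)"

end

(* Cutting an E-ended path at its last return u to the diagonal writes its step word as
   u N v E, where v is any nonempty path and u is empty or D-ended, since E N is forbidden.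
   As deleting a final D is unrestricted, F_D = x F and F_E = x (1 + x F) (F - 1), so
   (1 - x)^2 F = (1 - x) + x^2 F^2. The only power series solution is
   F = C(x^2 / (1 - x)^3) / (1 - x) with C the Catalan series, which expands to the first sum.
   The third sum is the difference of the first two, by Pascal's rule. *)

theory Submission
  imports Defs
begin

section \<open>Step words\<close>

lemmas step_defs = N_step_def E_step_def D_step_def

text \<open>Height of the end point above the diagonal. For k = 1, staying in the region y >= x
  means nonnegative height on every prefix.\<close>

definition ht :: "(int \<times> int) list \<Rightarrow> int" where
  "ht w = snd (sum_list w) - fst (sum_list w)"

lemma ht_simps [simp]:
  "ht [] = 0" "ht (s # w) = snd s - fst s + ht w" "ht (u @ v) = ht u + ht v"
  by (simp_all add: ht_def)

text \<open>With both forbidden patterns in one binary relation, \<open>successively\<close>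
  expresses their avoidance, and concatenation adds a single check at the seam.\<close>

definition compat :: "int \<times> int \<Rightarrow> int \<times> int \<Rightarrow> bool" where
  "compat s t \<longleftrightarrow> \<not> (s = N_step \<and> t = E_step) \<and> \<not> (s = E_step \<and> t = N_step)"

lemma compat_simps [simp]:
  "compat D_step s" "compat s D_step" "compat s s"
  "\<not> compat N_step E_step" "\<not> compat E_step N_step"
  by (auto simp: compat_def step_defs)

text \<open>The end point is left free, so prefixes of good words are good again; the decomposition
  of E-ended words depends on this.\<close>

definition good :: "(int \<times> int) list \<Rightarrow> bool" where
  "good w \<longleftrightarrow> set w \<subseteq> {N_step, E_step, D_step} \<and> (\<forall>u. prefix u w \<longrightarrow> 0 \<le> ht u)
    \<and> successively compat w"

definition step_words :: "nat \<Rightarrow> (int \<times> int) list set" where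
  "step_words n = {w. good w \<and> sum_list w = (int n, int n)}"

lemma good_Nil [simp]: "good []"
  by (simp add: good_def)

lemma good_append:
  "good (u @ v) \<longleftrightarrow> good u \<and> set v \<subseteq> {N_step, E_step, D_step}
    \<and> (\<forall>p. prefix p v \<longrightarrow> 0 \<le> ht u + ht p) \<and> successively compat v
    \<and> (u = [] \<or> v = [] \<or> compat (last u) (hd v))"
  by (auto simp: good_def prefix_append successively_append_iff)

text \<open>Every step raises x + y by at least 1. This bounds word lengths, hence gives
  finiteness.\<close>

lemma length_le_sum_list:
  "set w \<subseteq> {N_step, E_step, D_step} \<Longrightarrow>
    0 \<le> fst (sum_list w) \<and> int (length w) \<le> fst (sum_list w) + snd (sum_list w)"
  by (induction w) (auto simp: step_defs)

lemma ht_step_words: "w \<in> step_words n \<Longrightarrow> ht w = 0"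
  by (simp add: step_words_def ht_def)

lemma step_wordsI:
  assumes "good w" "ht w = 0"
  obtains n where "w \<in> step_words n"
proof -
  have "0 \<le> fst (sum_list w)"
    using assms(1) length_le_sum_list[of w] by (simp add: good_def)
  moreover have "snd (sum_list w) = fst (sum_list w)"
    using assms(2) by (simp add: ht_def)
  ultimately have "w \<in> step_words (nat (fst (sum_list w)))"
    using assms(1) by (simp add: step_words_def prod_eq_iff)
  then show thesis by (rule that)
qed

lemma length_step_words: "w \<in> step_words n \<Longrightarrow> length w \<le> 2 * n"
  using length_le_sum_list[of w] by (auto simp: step_words_def good_def)

lemma finite_step_words: "finite (step_words n)"
proof (rule finite_subset)
  show "step_words n \<subseteq> {w. set w \<subseteq> {N_step, E_step, D_step} \<and> length w \<le> 2 * n}"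
    using length_step_words by (auto simp: step_words_def good_def)
qed (rule finite_lists_length_le, simp)

lemma Nil_in_step_words [simp]: "[] \<in> step_words n \<longleftrightarrow> n = 0"
  by (auto simp: step_words_def zero_prod_def)

lemma step_words_0: "step_words 0 = {[]}"
  using length_step_words[of _ 0] by auto

lemma step_words_disjoint: "i \<noteq> j \<Longrightarrow> step_words i \<inter> step_words j = {}"
  by (auto simp: step_words_def)

text \<open>D keeps the height and is compatible with every neighbour, so it can be added or removed
  at the end freely.\<close>

lemma snoc_D_in_step_words: "w @ [D_step] \<in> step_words (Suc n) \<longleftrightarrow> w \<in> step_words n"
proof -
  have "sum_list (w @ [D_step]) = (int (Suc n), int (Suc n)) \<longleftrightarrow> sum_list w = (int n, int n)"
    by (auto simp: D_step_def prod_eq_iff)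
  moreover have "good (w @ [D_step]) \<longleftrightarrow> good w" if "ht w = 0"
  proof -
    have "ht [D_step] = 0" by (simp add: D_step_def)
    then show ?thesis
      unfolding good_append using that by (auto simp: prefix_Cons simp del: ht_simps(2))
  qed
  ultimately show ?thesis
    by (auto simp: step_words_def good_append ht_def)
qed

text \<open>Before a final N the path would be at height -1.\<close>

lemma last_step_words_neq_N:
  assumes "w \<in> step_words n" "w \<noteq> []"
  shows "last w \<noteq> N_step"
proof
  assume "last w = N_step"
  then obtain u where w: "w = u @ [N_step]"
    using assms(2) by (metis append_butlast_last_id)
  have "ht u \<ge> 0" using assms(1) by (auto simp: step_words_def good_def w)
  moreover have "ht w = 0" using assms(1) by (rule ht_step_words)
  ultimately show False by (simp add: w N_step_def)
qed

section \<open>Words classified by their last step\<close>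

definition D_words :: "nat \<Rightarrow> (int \<times> int) list set" where
  "D_words n = {w \<in> step_words n. w \<noteq> [] \<and> last w = D_step}"

definition E_words :: "nat \<Rightarrow> (int \<times> int) list set" where
  "E_words n = {w \<in> step_words n. w \<noteq> [] \<and> last w = E_step}"

lemma D_words_Suc: "D_words (Suc n) = (\<lambda>w. w @ [D_step]) ` step_words n"
proof (intro equalityI subsetI)
  fix w assume w: "w \<in> D_words (Suc n)"
  then have "w = butlast w @ [D_step]"
    by (metis (mono_tags, lifting) D_words_def append_butlast_last_id mem_Collect_eq)
  then show "w \<in> (\<lambda>w. w @ [D_step]) ` step_words n"
    using w snoc_D_in_step_words[of "butlast w" n] by (auto simp: D_words_def)
qed (auto simp: D_words_def snoc_D_in_step_words)

lemma card_D_words_Suc: "card (D_words (Suc n)) = card (step_words n)"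
  unfolding D_words_Suc by (rule card_image) (auto simp: inj_on_def)

lemma D_words_0: "D_words 0 = {}" and E_words_0: "E_words 0 = {}"
  by (auto simp: D_words_def E_words_def step_words_0)

lemma card_step_words:
  "card (step_words n) = (if n = 0 then 1 else 0) + card (D_words n) + card (E_words n)"
proof (cases "n = 0")
  case True
  then show ?thesis by (simp add: D_words_0 E_words_0 step_words_0)
next
  case False
  have "last w \<in> {N_step, E_step, D_step}" if "w \<in> step_words n" "w \<noteq> []" for w
    using that last_in_set by (fastforce simp: step_words_def good_def)
  then have "step_words n = D_words n \<union> E_words n"
    using False last_step_words_neq_N[of _ n] by (fastforce simp: D_words_def E_words_def)
  moreover have "D_words n \<inter> E_words n = {}"
    by (auto simp: D_words_def E_words_def step_defs)
  moreover have "finite (D_words n)" "finite (E_words n)"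
    using finite_step_words by (simp_all add: D_words_def E_words_def)
  ultimately show ?thesis using False by (simp add: card_Un_disjoint)
qed

section \<open>Cutting E-ended words at the last return to the diagonal\<close>

definition join :: "(int \<times> int) list \<times> (int \<times> int) list \<Rightarrow> (int \<times> int) list" where
  "join = (\<lambda>(u, v). u @ N_step # v @ [E_step])"

lemma inj_on_join: "inj_on join {(u, v). ht u = 0 \<and> good v}"
proof -
  \<comment> \<open>If u' were longer, it would be u followed by N and a prefix of v, hence of
    height at least 1. Applying this in both directions fixes the place of the cut.\<close>
  have aux: "length u' \<le> length u"
    if eq: "u @ N_step # v = u' @ N_step # v'" and "ht u' = 0" "ht u = 0" "good v" for u v u' v'
  proof (rule ccontr)
    assume "\<not> ?thesis"
    with eq obtain z where "u' = u @ z" "N_step # v = z @ N_step # v'" "z \<noteq> []"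
      by (auto simp: append_eq_append_conv2)
    then obtain z' where "u' = u @ N_step # z'" "v = z' @ N_step # v'"
      by (auto simp: Cons_eq_append_conv)
    moreover from this have "0 \<le> ht z'" using \<open>good v\<close> by (auto simp: good_def)
    ultimately show False using that by (simp add: N_step_def)
  qed
  show ?thesis
  proof (rule inj_onI)
    fix a b
    assume "a \<in> {(u, v). ht u = 0 \<and> good v}" "b \<in> {(u, v). ht u = 0 \<and> good v}"
      and eq: "join a = join b"
    then obtain u v u' v' where ab: "a = (u, v)" "b = (u', v')"
      and *: "ht u = 0" "good v" "ht u' = 0" "good v'" by blast
    from eq have eq': "u @ N_step # v = u' @ N_step # v'"
      unfolding ab join_def prod.case by (metis append_Cons append_assoc butlast_snoc)
    from aux[OF eq'] aux[OF eq'[symmetric]] * have "length u = length u'"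
      by (simp add: le_antisym)
    with eq' show "a = b" by (simp add: ab)
  qed
qed

text \<open>The possible factors before the separating N: a final E would form a valley with that N,
  and a word ending on the diagonal cannot end in N.\<close>

definition D_ended :: "nat \<Rightarrow> (int \<times> int) list set" where
  "D_ended i = {u \<in> step_words i. u = [] \<or> last u = D_step}"

text \<open>The possible factors between the separating N and the final E; an empty one would leave
  the peak NE.\<close>

definition nonempty_words :: "nat \<Rightarrow> (int \<times> int) list set" where
  "nonempty_words i = {v \<in> step_words i. v \<noteq> []}"

text \<open>Around v no forbidden pair arises: v cannot begin with E, which would go below the
  diagonal, nor end with N. The N before v only raises it by one.\<close>

lemma join_in_E_words:
  assumes u: "u \<in> D_ended i" and v: "v \<in> nonempty_words j"
  shows "join (u, v) \<in> E_words (Suc (i + j))"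
proof -
  have ht: "ht u = 0" "ht v = 0"
    using u v ht_step_words by (auto simp: D_ended_def nonempty_words_def)
  have gu: "good u" and gv: "good v" and "v \<noteq> []"
    using u v by (auto simp: D_ended_def nonempty_words_def step_words_def)
  have "ht [hd v] \<ge> 0"
  proof -
    have "prefix [hd v] v" using \<open>v \<noteq> []\<close> by (cases v) auto
    with gv show ?thesis by (simp only: good_def)
  qed
  then have "hd v \<noteq> E_step" by (auto simp: E_step_def)
  then have hd: "compat N_step (hd v)" by (auto simp: compat_def step_defs)
  have "last v \<noteq> N_step"
    using v last_step_words_neq_N by (auto simp: nonempty_words_def)
  then have last: "compat (last v) E_step" by (auto simp: compat_def step_defs)
  have "compat (last u) N_step" if "u \<noteq> []"
    using u that by (auto simp: D_ended_def)
  moreover have "0 \<le> ht u + ht p" if "prefix p (N_step # v @ [E_step])" for p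
  proof -
    have "p = [] \<or> (\<exists>q. p = N_step # q \<and> (q = v @ [E_step] \<or> prefix q v))"
      using that by (simp add: prefix_Cons)
    then show ?thesis using gv ht by (auto simp: good_def N_step_def E_step_def)
  qed
  moreover have "successively compat (N_step # v @ [E_step])"
    using gv hd last \<open>v \<noteq> []\<close>
    by (simp add: good_def successively_Cons successively_append_iff)
  moreover have "set (N_step # v @ [E_step]) \<subseteq> {N_step, E_step, D_step}"
    using gv by (simp add: good_def)
  ultimately have "good (join (u, v))"
    unfolding join_def prod.case good_append using gu by (simp only: list.sel) blast
  moreover have "sum_list (join (u, v)) = (int (Suc (i + j)), int (Suc (i + j)))"
    using u v by (simp add: join_def D_ended_def nonempty_words_def step_words_def step_defs)
  ultimately show ?thesis
    by (simp add: E_words_def step_words_def join_def)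
qed

lemma E_words_decompose:
  assumes w: "w \<in> E_words (Suc n)"
  obtains i u v where "i \<le> n" "u \<in> D_ended i" "v \<in> nonempty_words (n - i)" "w = join (u, v)"
proof -
  have gw: "good w" using w by (auto simp: E_words_def step_words_def)
  have htw: "ht w = 0" using w ht_step_words by (auto simp: E_words_def)
  obtain x where x: "w = x @ [E_step]"
    using w by (metis (mono_tags, lifting) E_words_def append_butlast_last_id mem_Collect_eq)
  have htx: "ht x = 1" using htw by (simp add: x E_step_def)
  have gx: "good x" using gw by (simp add: x good_append)
  \<comment> \<open>The cut is the longest prefix of height 0. It is sought in x, without the final
    E, because \<open>w\<close> itself has height 0.\<close>
  define P where "P u \<longleftrightarrow> prefix u x \<and> ht u = 0" for u
  have "P []" by (simp add: P_def)
  moreover have "\<forall>u. P u \<longrightarrow> length u < Suc (length x)"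
    by (auto simp: P_def less_Suc_eq_le prefix_length_le)
  ultimately have "\<exists>u. P u \<and> (\<forall>u'. P u' \<longrightarrow> length u' \<le> length u)"
    by (rule Lattices_Big.ex_has_greatest_nat)
  then obtain u where u: "P u" and max: "\<And>u'. P u' \<Longrightarrow> length u' \<le> length u"
    by blast
  obtain r where r: "x = u @ r" using u by (auto simp: P_def prefix_def)
  have "r \<noteq> []" using htx u by (auto simp: r P_def)
  then obtain s v where xv: "x = u @ s # v" by (cases r) (auto simp: r)
  \<comment> \<open>Past the cut the height is nonnegative by \<open>gx\<close> and nonzero by
    maximality. Hence v, which starts at height 1, never drops below its own starting level.\<close>
  have above: "ht (u @ s # z) > 0" if "prefix z v" for z
  proof -
    have pre: "prefix (u @ s # z) x" using that by (simp add: xv)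
    then have "ht (u @ s # z) \<ge> 0" using gx by (auto simp only: good_def)
    moreover have "ht (u @ s # z) \<noteq> 0" using pre max[of "u @ s # z"] by (auto simp: P_def)
    ultimately show ?thesis by simp
  qed
  \<comment> \<open>The first step after the cut leaves the diagonal upwards, and only N does
    so.\<close>
  have s: "s = N_step"
    using above[of "[]"] gx u by (auto simp: xv good_append P_def step_defs)
  have htv: "ht v = 0" using htx u by (simp add: xv s P_def N_step_def)
  have gu: "good u" using gx by (simp add: xv good_append)
  have "good v"
    unfolding good_def
  proof (intro conjI allI impI)
    show "set v \<subseteq> {N_step, E_step, D_step}" using gx by (auto simp: xv good_def)
    show "successively compat v"
      using gx by (auto simp: xv good_def successively_append_iff successively_Cons)
    show "0 \<le> ht z" if "prefix z v" for z
      using above[OF that] u by (simp add: s P_def N_step_def)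
  qed
  then obtain j where j: "v \<in> step_words j" using step_wordsI htv by blast
  obtain i where i: "u \<in> step_words i" using step_wordsI gu u P_def by blast
  have wj: "w = join (u, v)" by (simp add: x xv s join_def)
  have "v \<noteq> []" using gw by (auto simp: x xv s good_append)
  have ud: "u = [] \<or> last u = D_step"
  proof (rule disjCI)
    assume "last u \<noteq> D_step"
    show "u = []"
    proof (rule ccontr)
      assume "u \<noteq> []"
      then have "last u \<in> {N_step, E_step, D_step}"
        using gu last_in_set by (fastforce simp: good_def)
      moreover have "last u \<noteq> N_step" using last_step_words_neq_N i \<open>u \<noteq> []\<close> by blast
      ultimately have "last u = E_step" using \<open>last u \<noteq> D_step\<close> by blast
      then show False using gx \<open>u \<noteq> []\<close> by (simp add: xv s good_append)
    qed
  qed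
  have "sum_list w = (int (Suc n), int (Suc n))" using w by (simp add: E_words_def step_words_def)
  moreover have "sum_list w = (int (Suc (i + j)), int (Suc (i + j)))"
    using i j by (simp add: wj join_def step_words_def step_defs)
  \<comment> \<open>The outer N and E together advance the end point by one along the diagonal,
    which accounts for \<open>Suc\<close>.\<close>
  ultimately have "n = i + j" by simp
  then show thesis
    using that[of i u v] i j ud \<open>v \<noteq> []\<close> wj by (simp add: D_ended_def nonempty_words_def)
qed

text \<open>The decomposition is a bijection onto pairs, and pairs with different i are disjoint
  because their first components end at different points. The result is the coefficient of a Cauchy
  product.\<close>

lemma card_E_words_Suc:
  "card (E_words (Suc n)) = (\<Sum>i=0..n. card (D_ended i) * card (nonempty_words (n - i)))"
proof -
  let ?S = "\<lambda>i. D_ended i \<times> nonempty_words (n - i)"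
  have "E_words (Suc n) = join ` (\<Union>i\<in>{0..n}. ?S i)"
  proof (intro equalityI subsetI)
    fix w assume "w \<in> E_words (Suc n)"
    then show "w \<in> join ` (\<Union>i\<in>{0..n}. ?S i)"
      by (rule E_words_decompose) force
  qed (use join_in_E_words in fastforce)
  moreover have "inj_on join (\<Union>i\<in>{0..n}. ?S i)"
    by (rule inj_on_subset[OF inj_on_join])
      (auto simp: D_ended_def nonempty_words_def ht_step_words step_words_def[of "n - _"])
  ultimately have "card (E_words (Suc n)) = card (\<Union>i\<in>{0..n}. ?S i)"
    by (simp add: card_image)
  also have "\<dots> = (\<Sum>i=0..n. card (?S i))"
  proof (rule card_UN_disjoint)
    show "\<forall>i\<in>{0..n}. finite (?S i)"
      using finite_step_words by (auto simp: D_ended_def nonempty_words_def)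
    show "\<forall>i\<in>{0..n}. \<forall>j\<in>{0..n}. i \<noteq> j \<longrightarrow> ?S i \<inter> ?S j = {}"
      using step_words_disjoint by (fastforce simp: D_ended_def)
  qed simp
  finally show ?thesis by (simp add: card_cartesian_product)
qed

lemma card_D_ended_0: "card (D_ended 0) = 1"
proof -
  have "D_ended 0 = {[]}" by (auto simp: D_ended_def step_words_0)
  then show ?thesis by simp
qed

lemma card_D_ended_Suc: "card (D_ended (Suc n)) = card (step_words n)"
proof -
  have "D_ended (Suc n) = D_words (Suc n)"
    using Nil_in_step_words[of "Suc n"] by (auto simp: D_ended_def D_words_def simp del: Nil_in_step_words)
  then show ?thesis by (simp add: card_D_words_Suc)
qed

lemma card_nonempty_words: "card (nonempty_words n) = (if n = 0 then 0 else card (step_words n))"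
proof (cases "n = 0")
  case False
  then have "nonempty_words n = step_words n"
    using Nil_in_step_words[of n] by (auto simp: nonempty_words_def simp del: Nil_in_step_words)
  with False show ?thesis by simp
qed (simp add: nonempty_words_def step_words_0)

section \<open>Paths as step words\<close>

text \<open>Inverse of \<open>steps\<close> once the starting vertex is fixed.\<close>

primrec verts :: "int \<times> int \<Rightarrow> (int \<times> int) list \<Rightarrow> (int \<times> int) list" where
  "verts v [] = [v]"
| "verts v (s # w) = v # verts (v + s) w"

lemma steps_simps [simp]: "steps [x] = []" "steps (x # y # p) = (y - x) # steps (y # p)"
  by (simp_all add: steps_def)

lemma verts_neq_Nil [simp]: "verts v w \<noteq> []"
  by (cases w) auto

lemma hd_verts [simp]: "hd (verts v w) = v"
  by (cases w) auto

lemma steps_Cons: "p \<noteq> [] \<Longrightarrow> steps (x # p) = (hd p - x) # steps p"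
  by (cases p) auto

lemma steps_verts [simp]: "steps (verts v w) = w"
  by (induction w arbitrary: v) (simp_all add: steps_Cons)

lemma last_verts: "last (verts v w) = v + sum_list w"
  by (induction w arbitrary: v) (simp_all add: add.assoc)

text \<open>Each vertex is reached by a unique prefix length, so conditions on vertices become
  conditions on prefixes.\<close>

lemma set_verts: "set (verts v w) = (\<lambda>u. v + sum_list u) ` {u. prefix u w}"
proof (induction w arbitrary: v)
  case (Cons s w)
  have "{u. prefix u (s # w)} = insert [] ((#) s ` {u. prefix u w})"
    by (auto simp: prefix_Cons)
  then show ?case by (simp add: Cons image_image add.assoc)
qed simp

lemma verts_steps: "p \<noteq> [] \<Longrightarrow> verts (hd p) (steps p) = p"
proof (induction p)
  case (Cons x p)
  then show ?case by (cases "p = []") (simp_all add: steps_Cons)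
qed simp

text \<open>A two-letter factor is either at the head of the word or inside its tail, as in the
  recursion of \<open>successively\<close>.\<close>

lemma successively_compat_iff:
  "successively compat w \<longleftrightarrow> \<not> sublist [N_step, E_step] w \<and> \<not> sublist [E_step, N_step] w"
proof (induction w)
  case (Cons s w)
  then show ?case
    by (cases w) (auto simp: sublist_Cons_right compat_def)
qed simp

lemma verts_in_paths: "verts (0, 0) w \<in> paths 1 n \<longleftrightarrow> w \<in> step_words n"
proof -
  have "(\<forall>(x, y)\<in>set (verts (0, 0) w). int 1 * x \<le> y) \<longleftrightarrow> (\<forall>u. prefix u w \<longrightarrow> 0 \<le> ht u)"
    by (auto simp: set_verts ht_def zero_prod_def[symmetric] case_prod_beta)
  then show ?thesis
    unfolding paths_def step_words_def good_def delannoy_path_def mem_Collect_eq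
      successively_compat_iff
    by (simp add: last_verts zero_prod_def[symmetric]) blast
qed

lemma bij_betw_steps: "bij_betw steps (paths 1 n) (step_words n)"
proof (rule bij_betwI[where g = "verts (0, 0)"])
  have *: "verts (0, 0) (steps p) = p" if "p \<in> paths 1 n" for p
    using that verts_steps[of p] by (simp add: paths_def delannoy_path_def)
  then show "steps \<in> paths 1 n \<rightarrow> step_words n"
    using verts_in_paths by (metis Pi_I)
  show "verts (0, 0) (steps p) = p" if "p \<in> paths 1 n" for p
    using that by (rule *)
  show "verts (0, 0) \<in> step_words n \<rightarrow> paths 1 n"
    using verts_in_paths by blast
qed simp

lemma card_paths: "card (paths 1 n) = card (step_words n)"
  using bij_betw_steps by (rule bij_betw_same_card)

lemma card_paths_steps:
  "card {p \<in> paths 1 n. Q (steps p)} = card {w \<in> step_words n. Q w}"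
proof (rule bij_betw_same_card)
  show "bij_betw steps {p \<in> paths 1 n. Q (steps p)} {w \<in> step_words n. Q w}"
    using bij_betw_steps[of n] by (auto simp: bij_betw_def inj_on_def)
qed

lemma card_D_paths: "card (D_paths 1 n) = card (D_words n)"
  unfolding D_paths_def D_words_def by (rule card_paths_steps)

lemma card_E_paths: "card (E_paths 1 n) = card (E_words n)"
  unfolding E_paths_def E_words_def by (rule card_paths_steps)

section \<open>The quadratic equation and its solution\<close>

definition catalan_fps :: "real fps" where
  "catalan_fps = Abs_fps (\<lambda>m. 1 / (real m + 1) * real ((2 * m) choose m))"

text \<open>The factorial formulas give the ratio of the consecutive central binomials
  \<open>d\<close> and \<open>c\<close>; the left side is just \<open>d\<close>.\<close>

lemma catalan_fps_rec:
  "(real m + 2) * fps_nth catalan_fps (Suc m) = (4 * real m + 2) * fps_nth catalan_fps m"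
proof -
  define c d where "c = (2 * m) choose m" and "d = (2 * m + 2) choose (m + 1)"
  have "fact m * fact m * c = fact (2 * m)"
    using binomial_fact_lemma[of m "2 * m"] by (simp add: c_def)
  then have c: "real c * (fact m * fact m) = fact (2 * m)"
    by (metis mult.commute of_nat_fact of_nat_mult)
  have "fact (m + 1) * fact (m + 1) * d = fact (2 * m + 2)"
    using binomial_fact_lemma[of "m + 1" "2 * m + 2"] by (simp add: d_def)
  then have d: "real d * (fact (m + 1) * fact (m + 1)) = fact (2 * m + 2)"
    by (metis mult.commute of_nat_fact of_nat_mult)
  have "(real d * (real m + 1)\<^sup>2) * (fact m * fact m) = fact (2 * m + 2)"
    unfolding d[symmetric] by (simp add: algebra_simps power2_eq_square)
  also have "\<dots> = (2 * real m + 2) * (2 * real m + 1) * fact (2 * m)"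
    by (simp add: algebra_simps)
  also have "\<dots> = (2 * (real m + 1) * (2 * real m + 1) * real c) * (fact m * fact m)"
    unfolding c[symmetric] by (simp add: algebra_simps)
  finally have "real d * (real m + 1)\<^sup>2 = 2 * (real m + 1) * (2 * real m + 1) * real c"
    by simp
  then have "((real m + 1)\<^sup>2) * real d = (real m + 1)\<^sup>2 * ((4 * real m + 2) * (real c / (real m + 1)))"
    by (simp add: field_simps power2_eq_square)
  then have "real d = (4 * real m + 2) * (real c / (real m + 1))"
    by (subst (asm) mult_left_cancel) auto
  moreover have "(real m + 2) * fps_nth catalan_fps (Suc m) = real d"
    by (simp add: catalan_fps_def d_def add.commute)
  moreover have "fps_nth catalan_fps m = real c / (real m + 1)"
    by (simp add: catalan_fps_def c_def)
  ultimately show ?thesis by (simp only:)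
qed

text \<open>Compares coefficients of \<open>\<surd>(1 - 4 X) = 1 - 2 X C\<close>.\<close>

lemma catalan_fps_equation: "catalan_fps = 1 + fps_X * catalan_fps\<^sup>2"
proof -
  \<comment> \<open>\<open>S\<close> is the square root of 1 - 4X, written as a binomial series with
    exponent 1/2.\<close>
  define S :: "real fps" where "S = fps_binomial (1 / 2) oo (fps_const (-4) * fps_X)"
  have S_nth: "fps_nth S n = (-4) ^ n * ((1 / 2) gchoose n)" for n
    unfolding S_def by (subst fps_nth_compose_linear) simp
  have S_rec: "(real n + 1) * fps_nth S (Suc n) = (4 * real n - 2) * fps_nth S n" for n
  proof -
    have "(real n + 1) * ((1 / 2) gchoose Suc n) = (1 / 2 - real n) * ((1 / 2 :: real) gchoose n)"
      using gbinomial_mult_1[of "1 / 2 :: real" n] by (simp add: algebra_simps)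
    moreover have "(real n + 1) * fps_nth S (Suc n)
        = (-4) ^ Suc n * ((real n + 1) * ((1 / 2) gchoose Suc n))"
      by (simp add: S_nth del: of_nat_Suc)
    ultimately have "(real n + 1) * fps_nth S (Suc n)
        = (-4) ^ Suc n * ((1 / 2 - real n) * ((1 / 2) gchoose n))"
      by (simp only:)
    then show ?thesis by (simp add: S_nth algebra_simps)
  qed
  \<comment> \<open>Shifted by one index, \<open>S_rec\<close> is the Catalan recurrence, so the two
    sequences are proportional; index 0 gives the factor -2.\<close>
  have S_Suc: "fps_nth S (Suc m) = - 2 * fps_nth catalan_fps m" for m
  proof (induction m)
    case 0
    show ?case using S_rec[of 0] by (simp add: S_nth catalan_fps_def)
  next
    case (Suc m)
    have "(real m + 2) * fps_nth S (Suc (Suc m)) = (4 * real m + 2) * fps_nth S (Suc m)"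
      using S_rec[of "Suc m"] by (simp add: algebra_simps)
    also have "\<dots> = -2 * ((4 * real m + 2) * fps_nth catalan_fps m)"
      by (simp add: Suc algebra_simps)
    also have "\<dots> = (real m + 2) * (- 2 * fps_nth catalan_fps (Suc m))"
      by (simp only: catalan_fps_rec[symmetric])
    finally have "(real m + 2) * fps_nth S (Suc (Suc m))
      = (real m + 2) * (- 2 * fps_nth catalan_fps (Suc m))" .
    moreover have "real m + 2 \<noteq> 0" by linarith
    ultimately show ?case by (metis mult_left_cancel)
  qed
  have S: "S = 1 - fps_X * (fps_const 2 * catalan_fps)"
  proof (rule fps_ext)
    fix n
    show "fps_nth S n = fps_nth (1 - fps_X * (fps_const 2 * catalan_fps)) n"
    proof (cases n)
      case 0
      then show ?thesis by (simp add: S_nth)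
    next
      case (Suc m)
      then show ?thesis by (simp add: S_Suc)
    qed
  qed
  \<comment> \<open>The exponents add up to 1, so the product of the binomial series collapses to 1
    + X before the substitution.\<close>
  have "S * S = (fps_binomial (1 / 2) * fps_binomial (1 / 2)) oo (fps_const (-4) * fps_X)"
    unfolding S_def by (subst fps_compose_mult_distrib) simp_all
  also have "\<dots> = (1 + fps_X) oo (fps_const (-4) * fps_X)"
    by (simp add: fps_binomial_add_mult[symmetric] fps_binomial_1)
  also have "\<dots> = 1 + fps_const (-4) * fps_X"
    by (simp add: fps_compose_add_distrib)
  also have "fps_const (-4) = (- 4 :: real fps)"
    by (simp only: numeral_fps_const fps_const_neg)
  finally have SS: "S * S = 1 - 4 * fps_X" by simp
  have "fps_const 2 = (2 :: real fps)" by (rule numeral_fps_const[symmetric])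
  with S have S': "S = 1 - 2 * fps_X * catalan_fps" by simp
  \<comment> \<open>Expanding the square of 1 - 2XC and comparing with 1 - 4X leaves the equation
    times 4X, which can be cancelled.\<close>
  have "4 * fps_X * catalan_fps = 4 * fps_X * (1 + fps_X * catalan_fps\<^sup>2)"
    using SS unfolding S' by (simp add: algebra_simps power2_eq_square)
  then show ?thesis by simp
qed

text \<open>Negative binomial series: multiplying by 1 - X takes differences of coefficients, which
  by Pascal's rule lowers m by one. The power of X shifts the index by k.\<close>

lemma fps_X_power_mult_inverse_one_minus_nth:
  "fps_nth (fps_X ^ k * inverse (1 - fps_X :: 'a :: field fps) ^ Suc m) n
    = (if n < k then 0 else of_nat ((n - k + m) choose m))"
proof -
  define Q :: "nat \<Rightarrow> 'a fps" where "Q m = Abs_fps (\<lambda>n. of_nat ((n + m) choose m))" for m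
  have step: "(1 - fps_X) * Q (Suc m) = Q m" for m
  proof (rule fps_ext)
    fix n show "fps_nth ((1 - fps_X) * Q (Suc m)) n = fps_nth (Q m) n"
      by (cases n) (simp_all add: Q_def algebra_simps binomial_eq_0 del: of_nat_Suc)
  qed
  have "(1 - fps_X) ^ Suc m * Q m = 1" for m
  proof (induction m)
    case 0
    show ?case
    proof (rule fps_ext)
      fix n show "fps_nth ((1 - fps_X) ^ Suc 0 * Q 0) n = fps_nth 1 n"
        by (cases n) (simp_all add: Q_def algebra_simps)
    qed
  next
    case (Suc m)
    have "(1 - fps_X) ^ Suc (Suc m) * Q (Suc m) = (1 - fps_X) ^ Suc m * ((1 - fps_X) * Q (Suc m))"
      by (simp add: algebra_simps)
    then show ?case by (simp only: step Suc)
  qed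
  then have "inverse ((1 - fps_X) ^ Suc m) = Q m"
    by (rule fps_inverse_unique)
  then have "inverse (1 - fps_X) ^ Suc m = Q m"
    by (simp only: fps_inverse_power)
  then show ?thesis by (simp add: fps_X_power_mult_nth Q_def)
qed

section \<open>The power series solution of the quadratic equation and its coefficients\<close>

definition delannoy_series :: "real fps" where
  "delannoy_series = inverse (1 - fps_X) * (catalan_fps oo (fps_X\<^sup>2 * inverse (1 - fps_X) ^ 3))"

text \<open>Substituting t in C = 1 + X C^2 gives K = 1 + t K^2. Multiplied by 1 - X, one of the
  three factors \<open>I\<close> in t cancels and the other two combine with K^2 into the square of
  the series.\<close>

lemma delannoy_series_equation:
  "(1 - fps_X)\<^sup>2 * delannoy_series = (1 - fps_X) + fps_X\<^sup>2 * delannoy_series\<^sup>2"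
proof -
  define I :: "real fps" where "I = inverse (1 - fps_X)"
  define t where "t = fps_X\<^sup>2 * I ^ 3"
  define K where "K = catalan_fps oo t"
  have t0: "fps_nth t 0 = 0" by (simp add: t_def)
  have I: "(1 - fps_X) * I = 1"
    unfolding I_def by (rule inverse_mult_eq_1') simp
  have "K = (1 + fps_X * catalan_fps\<^sup>2) oo t"
    unfolding K_def by (subst catalan_fps_equation) (rule refl)
  also have "\<dots> = 1 + t * K\<^sup>2"
    by (simp add: fps_compose_add_distrib fps_compose_mult_distrib t0 K_def power2_eq_square)
  finally have K: "K = 1 + t * K\<^sup>2" .
  have G: "delannoy_series = I * K"
    by (simp add: delannoy_series_def I_def K_def t_def)
  have "(1 - fps_X)\<^sup>2 * delannoy_series = (1 - fps_X) * ((1 - fps_X) * I) * K"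
    by (simp add: G power2_eq_square algebra_simps)
  also have "\<dots> = (1 - fps_X) * K" by (simp only: I mult_1_right)
  also have "\<dots> = (1 - fps_X) * (1 + t * K\<^sup>2)" using K by simp
  also have "\<dots> = (1 - fps_X) + ((1 - fps_X) * I) * (fps_X\<^sup>2 * (I * K)\<^sup>2)"
    by (simp add: t_def power2_eq_square power3_eq_cube algebra_simps)
  also have "\<dots> = (1 - fps_X) + fps_X\<^sup>2 * (I * K)\<^sup>2" by (simp only: I mult_1_left)
  finally show ?thesis by (simp only: G)
qed

text \<open>The difference of the equations for two solutions factors as their difference times a
  series with constant term 1, and power series over the reals have no zero divisors.\<close>

lemma delannoy_series_unique:
  fixes f :: "real fps"
  assumes "(1 - fps_X)\<^sup>2 * f = (1 - fps_X) + fps_X\<^sup>2 * f\<^sup>2"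
  shows "f = delannoy_series"
proof -
  let ?g = "delannoy_series" and ?u = "(1 - fps_X)\<^sup>2 - fps_X\<^sup>2 * (f + delannoy_series)"
  have "(f - ?g) * ?u = ((1 - fps_X)\<^sup>2 * f - fps_X\<^sup>2 * f\<^sup>2) - ((1 - fps_X)\<^sup>2 * ?g - fps_X\<^sup>2 * ?g\<^sup>2)"
    by (simp add: algebra_simps power2_eq_square)
  also have "\<dots> = 0"
    by (simp add: assms delannoy_series_equation)
  finally have "(f - ?g) * ?u = 0" .
  moreover have "fps_nth ?u 0 = 1" by (simp add: power2_eq_square)
  then have "?u \<noteq> 0" by (metis fps_zero_nth zero_neq_one)
  ultimately show ?thesis by simp
qed

lemma delannoy_series_has_sum:
  "((\<lambda>m. 1 / (real m + 1) * real ((2 * m) choose m) * real ((n + m) choose (3 * m)))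
    has_sum fps_nth delannoy_series n) {0..}"
proof (rule has_sum_finite_neutralI)
  define I :: "real fps" where "I = inverse (1 - fps_X)"
  define t where "t = fps_X\<^sup>2 * I ^ 3"
  have t_nth: "fps_nth (t ^ i) j = 0" if "j < i" for i j
    using that by (intro startsby_zero_power_prefix[rule_format]) (auto simp: t_def)
  \<comment> \<open>Since t has no constant term, its i-th power starts at degree i or later. The
    composition sum can thus run up to n for all j <= n, so the sums can be swapped below.\<close>
  have t_comp: "fps_nth (catalan_fps oo t) j
      = (\<Sum>i\<in>{0..n}. fps_nth catalan_fps i * fps_nth (t ^ i) j)" if "j \<le> n" for j
    unfolding fps_compose_nth using that t_nth
    by (intro sum.mono_neutral_left) auto
  have coeff: "fps_nth (I * t ^ i) n = real ((n + i) choose (3 * i))" for i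
  proof -
    have "I * t ^ i = fps_X ^ (2 * i) * I ^ Suc (3 * i)"
      by (simp add: t_def power_mult_distrib power_mult)
    then have "fps_nth (I * t ^ i) n = (if n < 2 * i then 0 else real ((n - 2 * i + 3 * i) choose (3 * i)))"
      by (simp only: I_def fps_X_power_mult_inverse_one_minus_nth)
    \<comment> \<open>The case n < 2i needs no separate treatment: there n + i < 3i, so the binomial
      is 0.\<close>
    also have "\<dots> = real ((n + i) choose (3 * i))"
      by (auto simp: binomial_eq_0 intro!: arg_cong2[of _ _ _ _ binomial])
    finally show ?thesis .
  qed
  have "fps_nth delannoy_series n = fps_nth ((catalan_fps oo t) * I) n"
    by (simp only: delannoy_series_def I_def t_def mult.commute)
  also have "\<dots> = (\<Sum>j=0..n. fps_nth I (n - j) * fps_nth (catalan_fps oo t) j)"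
    unfolding fps_mult_nth by (intro sum.cong refl mult.commute)
  also have "\<dots> = (\<Sum>j=0..n. \<Sum>i=0..n. fps_nth I (n - j) * (fps_nth catalan_fps i * fps_nth (t ^ i) j))"
    by (intro sum.cong refl) (simp add: t_comp sum_distrib_left)
  also have "\<dots> = (\<Sum>i=0..n. \<Sum>j=0..n. fps_nth I (n - j) * (fps_nth catalan_fps i * fps_nth (t ^ i) j))"
    by (rule sum.swap)
  also have "\<dots> = (\<Sum>i=0..n. fps_nth catalan_fps i * fps_nth (t ^ i * I) n)"
    unfolding fps_mult_nth sum_distrib_left by (intro sum.cong refl) simp
  also have "\<dots> = (\<Sum>i=0..n. fps_nth catalan_fps i * fps_nth (I * t ^ i) n)"
    by (simp only: mult.commute)
  also have "\<dots> = (\<Sum>i=0..n. fps_nth catalan_fps i * real ((n + i) choose (3 * i)))"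
    by (simp only: coeff)
  finally show "fps_nth delannoy_series n = (\<Sum>m\<in>{0..n}.
      1 / (real m + 1) * real ((2 * m) choose m) * real ((n + m) choose (3 * m)))"
    by (simp add: catalan_fps_def)
qed auto

section \<open>Generating functions\<close>

lemma F_D_eq: "F_D 1 = fps_X * F 1"
proof (rule fps_ext)
  fix n show "fps_nth (F_D 1) n = fps_nth (fps_X * F 1) n"
    by (cases n) (simp_all add: F_D_def F_def card_D_paths card_paths card_D_words_Suc
        del: One_nat_def)
qed

lemma F_E_eq: "F_E 1 = fps_X * ((1 + fps_X * F 1) * (F 1 - 1))"
proof (rule fps_ext)
  \<comment> \<open>The 1 counts the empty word, and x F counts arbitrary words followed by
    D.\<close>
  have A: "1 + fps_X * F 1 = Abs_fps (\<lambda>i. real (card (D_ended i)))"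
  proof (rule fps_ext)
    fix n show "fps_nth (1 + fps_X * F 1) n = fps_nth (Abs_fps (\<lambda>i. real (card (D_ended i)))) n"
      by (cases n) (simp_all add: F_def card_paths card_D_ended_0 card_D_ended_Suc
          del: One_nat_def)
  qed
  have B: "F 1 - 1 = Abs_fps (\<lambda>i. real (card (nonempty_words i)))"
  proof (rule fps_ext)
    fix n show "fps_nth (F 1 - 1) n = fps_nth (Abs_fps (\<lambda>i. real (card (nonempty_words i)))) n"
      by (cases n) (simp_all add: F_def card_paths card_nonempty_words step_words_0 del: One_nat_def)
  qed
  fix n show "fps_nth (F_E 1) n = fps_nth (fps_X * ((1 + fps_X * F 1) * (F 1 - 1))) n"
    unfolding A B
    by (cases n) (simp_all add: F_E_def card_E_paths card_E_words_Suc
        fps_mult_nth[of "Abs_fps _" "Abs_fps _"] del: One_nat_def)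
qed

lemma F_eq: "F 1 = 1 + F_D 1 + F_E 1"
proof (rule fps_ext)
  fix n show "fps_nth (F 1) n = fps_nth (1 + F_D 1 + F_E 1) n"
    using card_step_words[of n]
    by (cases n) (simp_all add: F_def F_D_def F_E_def card_paths card_D_paths card_E_paths
        D_words_0 E_words_0 del: One_nat_def)
qed

lemma F_eq_delannoy_series: "F 1 = delannoy_series"
proof (rule delannoy_series_unique)
  \<comment> \<open>The defect of the quadratic equation is, as a polynomial identity in x and F,
    the defect of F = 1 + F_D + F_E.\<close>
  have "(1 - fps_X)\<^sup>2 * F 1 - ((1 - fps_X) + fps_X\<^sup>2 * (F 1)\<^sup>2)
      = F 1 - (1 + fps_X * F 1 + fps_X * ((1 + fps_X * F 1) * (F 1 - 1)))"
    by (simp add: algebra_simps power2_eq_square)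
  also have "\<dots> = 0"
    using F_eq by (simp only: F_D_eq F_E_eq) simp
  finally show "(1 - fps_X)\<^sup>2 * F 1 = (1 - fps_X) + fps_X\<^sup>2 * (F 1)\<^sup>2"
    by simp
qed

theorem theorem4:
  shows "(\<forall>n::nat. ((\<lambda>m::nat. 1 / (real m + 1) * real ((2 * m) choose m) * real ((n + m) choose (3 * m)))
            has_sum fps_nth (F 1) n) {0..})
    \<and> (\<forall>n::nat. n \<ge> 1 \<longrightarrow>
          ((\<lambda>m::nat. 1 / (real m + 1) * real ((2 * m) choose m) * real ((n + m - 1) choose (3 * m)))
            has_sum fps_nth (F_D 1) n) {0..})
    \<and> (\<forall>n::nat. n \<ge> 1 \<longrightarrow>
          ((\<lambda>m::nat. 1 / (real m + 1) * real ((2 * m) choose m) * real ((n + m - 1) choose (3 * m - 1)))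
            has_sum fps_nth (F_E 1) n) {1..})"
proof -
  let ?c = "\<lambda>m. 1 / (real m + 1) * real ((2 * m) choose m)"
  have F: "((\<lambda>m. ?c m * real ((n + m) choose (3 * m))) has_sum fps_nth (F 1) n) {0..}" for n
    unfolding F_eq_delannoy_series by (rule delannoy_series_has_sum)
  \<comment> \<open>F_D is F shifted by one, so the first sum is used at n - 1; n >= 1 makes the
    truncated subtraction harmless.\<close>
  have D: "((\<lambda>m. ?c m * real ((n + m - 1) choose (3 * m))) has_sum fps_nth (F_D 1) n) {0..}"
    if "n \<ge> 1" for n
    using F[of "n - 1"] that unfolding F_D_eq by simp
  have E: "((\<lambda>m. ?c m * real ((n + m - 1) choose (3 * m - 1))) has_sum fps_nth (F_E 1) n) {1..}"
    if n: "n \<ge> 1" for n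
  proof -
    let ?f = "\<lambda>m. ?c m * real ((n + m) choose (3 * m)) + - (?c m * real ((n + m - 1) choose (3 * m)))"
    have "(?f has_sum fps_nth (F 1) n + - fps_nth (F_D 1) n) {0..}"
      by (intro has_sum_add has_sum_uminusI F D n)
    also have "fps_nth (F 1) n + - fps_nth (F_D 1) n = fps_nth (F_E 1) n"
      using n by (subst F_eq) simp
    also have "(?f has_sum fps_nth (F_E 1) n) {0..} \<longleftrightarrow>
        ((\<lambda>m. ?c m * real ((n + m - 1) choose (3 * m - 1))) has_sum fps_nth (F_E 1) n) {1..}"
    \<comment> \<open>The index set can shrink because at m = 0 both binomials are 1 and the terms
      cancel. For m >= 1 the lower index 3m is positive and Pascal's rule applies.\<close>
    proof (rule has_sum_cong_neutral)
      fix m :: nat assume "m \<in> {0..} \<inter> {1..}"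
      then have "(n + m) choose (3 * m) = ((n + m - 1) choose (3 * m - 1)) + ((n + m - 1) choose (3 * m))"
        using choose_reduce_nat[of "n + m" "3 * m"] n by simp
      then show "?f m = ?c m * real ((n + m - 1) choose (3 * m - 1))"
        by (simp only: of_nat_add distrib_left)
    qed (auto simp: not_le)
    finally show ?thesis .
  qed
  show ?thesis
    using F D E by blast
qed

end
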